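(* There is no bipartite circle graph $G$ whose independence complex $I(G)$ is homotopy equivalent to a wedge $\bigvee_{k} S^1$ of $k$ circles with $k \geq 3$.
   Context: A chord diagram is a circle with finitely many chords with pairwise distinct endpoints on the circle; its intersection graph has one vertex per chord, with adjacency iff chords intersect. A circle graph is the intersection graph of some chord diagram. For a simple graph $G$, the independence complex $I(G)$ is the simplicial complex on the vertices of $G$ whose simplices are the nonempty sets of pairwise non-adjacent vertices. $\bigvee_k S^1$ denotes the one-point union of $k$ copies of the circle. *)

theory Defs
  imports "HOL-Analysis.Analysis"
begin

definition simple_graph :: "'a set \<Rightarrow> ('a \<Rightarrow> 'a \<Rightarrow> bool) \<Rightarrow> bool" where
  "simple_graph V E \<longleftrightarrow> finite V \<and> (\<forall>v w. E v w \<longrightarrow> v \<in> V \<and> w \<in> V)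
     \<and> (\<forall>v w. E v w \<longrightarrow> E w v) \<and> (\<forall>v. \<not> E v v)"

definition bipartite :: "'a set \<Rightarrow> ('a \<Rightarrow> 'a \<Rightarrow> bool) \<Rightarrow> bool" where
  "bipartite V E \<longleftrightarrow> (\<exists>A \<subseteq> V. \<forall>v w. E v w \<longrightarrow> (v \<in> A \<longleftrightarrow> w \<notin> A))"

definition circle_graph :: "'a set \<Rightarrow> ('a \<Rightarrow> 'a \<Rightarrow> bool) \<Rightarrow> bool" where
  "circle_graph V E \<longleftrightarrow> (\<exists>a b :: 'a \<Rightarrow> complex.
     (\<forall>v\<in>V. norm (a v) = 1 \<and> norm (b v) = 1 \<and> a v \<noteq> b v) \<and>
     (\<forall>v\<in>V. \<forall>w\<in>V. v \<noteq> w \<longrightarrow> {a v, b v} \<inter> {a w, b w} = {}) \<and>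
     (\<forall>v\<in>V. \<forall>w\<in>V. v \<noteq> w \<longrightarrow>
        (E v w \<longleftrightarrow> closed_segment (a v) (b v) \<inter> closed_segment (a w) (b w) \<noteq> {})))"

definition ind_simplex :: "'a set \<Rightarrow> ('a \<Rightarrow> 'a \<Rightarrow> bool) \<Rightarrow> 'a set \<Rightarrow> bool" where
  "ind_simplex V E \<sigma> \<longleftrightarrow> \<sigma> \<noteq> {} \<and> \<sigma> \<subseteq> V \<and> (\<forall>v\<in>\<sigma>. \<forall>w\<in>\<sigma>. \<not> E v w)"

text \<open>Standard geometric realization of I(G) inside the space of real functions on vertices
  (product topology; for finite V this is the Euclidean topology on R^V).\<close>
definition independence_complex_realization ::
  "'a set \<Rightarrow> ('a \<Rightarrow> 'a \<Rightarrow> bool) \<Rightarrow> ('a \<Rightarrow> real) topology" where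
  "independence_complex_realization V E =
     subtopology (product_topology (\<lambda>_. euclideanreal) UNIV)
       {f. \<exists>\<sigma>. ind_simplex V E \<sigma> \<and> (\<forall>x. 0 \<le> f x) \<and> (\<forall>x. x \<notin> \<sigma> \<longrightarrow> f x = 0)
               \<and> sum f \<sigma> = 1}"

text \<open>Wedge of k circles: the circles |z - j| = j, j = 1..k, in the plane; they meet
  pairwise only at the origin.\<close>
definition wedge_of_circles :: "nat \<Rightarrow> complex topology" where
  "wedge_of_circles k = top_of_set (\<Union>j\<in>{1..k}. sphere (of_nat j) (of_nat j))"

end

(* Maps into the punctured plane, up to maps with a continuous logarithm, stand in for first cohomology.
   Let A, B be the colour classes. The points of |I(G)| with mass at least 1/2 on A form a
   contractible set, and likewise for B, so a map g into the punctured plane has a logarithm on each half.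
   On the common boundary the two logarithms differ by an integer multiple of 2 pi i. This integer depends
   only on a non-adjacent pair a in A, b in B of support vertices, and it is the same for pairs that
   share a vertex; so pairs with different integers are adjacent crosswise. Four different values
   would give an induced K_{4,4} minus a perfect matching, which is no circle graph. Hence there are at most
   three values, and of any three maps g a nontrivial product of integer powers has a logarithm. On a wedge of
   three or more circles the projections onto three of the circles violate this. *)
theory Submission
  imports Defs
begin

section \<open>Chords of the unit disc and a forbidden circle graph\<close>

text \<open>The vanishing imaginary part makes \<open>z - p\<close> a real multiple \<open>s\<close>
  of \<open>q - p\<close>. As \<open>p\<close> and \<open>q\<close> are unit vectors,
  \<open>(norm z)^2 = 1 - s * (1 - s) * (norm (q - p))^2\<close>, so \<open>norm z <= 1\<close>
  forces \<open>0 <= s <= 1\<close>.\<close>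

lemma chord_line_in_disc:
  fixes p q z :: complex
  assumes pq: "norm p = 1" "norm q = 1" "p \<noteq> q" and z: "norm z \<le> 1"
    and on_line: "Im ((z - p) * cnj (q - p)) = 0"
  shows "z \<in> closed_segment p q"
proof -
  \<comment> \<open>The coefficient of the orthogonal projection of \<open>z - p\<close> onto
    \<open>q - p\<close>.\<close>
  define s where "s = Re ((z - p) * cnj (q - p)) / (norm (q - p))\<^sup>2"
  have "(z - p) * cnj (q - p) = of_real (Re ((z - p) * cnj (q - p)))"
    using on_line by (simp add: complex_eq_iff)
  moreover have "(q - p) * cnj (q - p) = of_real ((norm (q - p))\<^sup>2)"
    by (simp only: complex_norm_square)
  ultimately have "(z - p) * cnj (q - p) = of_real s * (q - p) * cnj (q - p)"
    using pq(3) by (simp add: s_def mult.assoc)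
  then have "z - p = of_real s * (q - p)"
    using pq(3) by simp
  then have zs: "z = p + of_real s * (q - p)"
    by (simp add: algebra_simps)
  have sq: "(norm z)\<^sup>2 = (1 - s) * (norm p)\<^sup>2 + s * (norm q)\<^sup>2 - s * (1 - s) * (norm (q - p))\<^sup>2"
    unfolding zs cmod_power2 by (simp add: algebra_simps power2_eq_square)
  have "(norm z)\<^sup>2 \<le> 1"
    using z by (simp add: power_le_one)
  with sq pq have "s * (1 - s) * (norm (q - p))\<^sup>2 \<ge> 0" by simp
  then have "s * (1 - s) \<ge> 0"
    using pq(3) by (simp add: zero_le_mult_iff)
  then have "0 \<le> s" "s \<le> 1" by (auto simp: zero_le_mult_iff)
  then show ?thesis
    unfolding closed_segment_def
    by (intro CollectI exI[of _ s]) (simp add: zs algebra_simps scaleR_conv_of_real)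
qed

text \<open>By the intermediate value theorem on the connected set \<open>C\<close>, some point of
  \<open>C\<close> lies on the line through \<open>p\<close> and \<open>q\<close>; being in the
  disc, it lies on the chord itself.\<close>

lemma convex_across_line_meets_chord:
  fixes p q u v :: complex
  assumes pq: "norm p = 1" "norm q = 1" "p \<noteq> q"
    and C: "convex C" "C \<subseteq> cball 0 1" "u \<in> C" "v \<in> C"
    and sides: "Im ((u - p) * cnj (q - p)) \<le> 0" "Im ((v - p) * cnj (q - p)) \<ge> 0"
  shows "C \<inter> closed_segment p q \<noteq> {}"
proof -
  have "connected ((\<lambda>z. Im ((z - p) * cnj (q - p))) ` C)"
    by (intro connected_continuous_image continuous_intros convex_connected C)
  then have "0 \<in> (\<lambda>z. Im ((z - p) * cnj (q - p))) ` C"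
    using sides C(3,4) by (meson connectedD_interval imageI)
  then obtain z where "z \<in> C" "Im ((z - p) * cnj (q - p)) = 0" by force
  with chord_line_in_disc[OF pq] C(2) show ?thesis by (auto simp: subset_iff)
qed

text \<open>Avoiding the chord, \<open>C\<close> and \<open>C'\<close> each stay strictly on one
  side of its line. The point \<open>y\<close> of the chord between \<open>x\<close> and
  \<open>x'\<close> shows that these sides are opposite, so \<open>D\<close>, which reaches both,
  has to cross the line inside the disc.\<close>

lemma chord_separates:
  fixes p q :: complex
  assumes pq: "norm p = 1" "norm q = 1" "p \<noteq> q"
    and C: "convex C" "C \<subseteq> cball 0 1" "C \<inter> closed_segment p q = {}" "x \<in> C"
    and C': "convex C'" "C' \<subseteq> cball 0 1" "C' \<inter> closed_segment p q = {}" "x' \<in> C'"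
    and y: "y \<in> closed_segment p q" "y \<in> closed_segment x x'"
    and D: "convex D" "D \<subseteq> cball 0 1" "D \<inter> C \<noteq> {}" "D \<inter> C' \<noteq> {}"
  shows "D \<inter> closed_segment p q \<noteq> {}"
proof -
  \<comment> \<open>\<open>L z\<close> is, up to sign, \<open>norm (q - p)\<close> times the
    distance of \<open>z\<close> from the line through \<open>p\<close> and \<open>q\<close>; its
    sign tells the side.\<close>
  define L where "L = (\<lambda>z. Im ((z - p) * cnj (q - p)))"
  have across: "C \<inter> closed_segment p q \<noteq> {}"
    if "convex C" "C \<subseteq> cball 0 1" "u \<in> C" "v \<in> C" "L u \<le> 0" "L v \<ge> 0" for C u v
    using convex_across_line_meets_chord[OF pq that(1-4)] that(5,6) unfolding L_def by blast
  have nz: "L z \<noteq> 0" if "z \<in> C \<union> C'" for z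
    using chord_line_in_disc[OF pq, of z] that C C' unfolding L_def by (auto simp: subset_iff)
  have "L y = 0"
  proof -
    obtain u where "y = (1 - u) *\<^sub>R p + u *\<^sub>R q"
      using y(1) unfolding closed_segment_def by auto
    then have "y - p = of_real u * (q - p)" by (simp add: algebra_simps scaleR_conv_of_real)
    then have "(y - p) * cnj (q - p) = of_real (u * (norm (q - p))\<^sup>2)"
      by (simp only: of_real_mult complex_norm_square mult.assoc)
    then show ?thesis unfolding L_def by (simp only: Im_complex_of_real)
  qed
  obtain t where t: "0 \<le> t" "t \<le> 1" "y = (1 - t) *\<^sub>R x + t *\<^sub>R x'"
    using y(2) unfolding closed_segment_def by auto
  have "L y = (1 - t) * L x + t * L x'"
    unfolding L_def t(3) by (simp add: algebra_simps)
  then have lin: "(1 - t) * L x + t * L x' = 0" using \<open>L y = 0\<close> by simp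
  \<comment> \<open>By \<open>lin\<close>, 0 is a convex combination of the nonzero numbers
    \<open>L x\<close> and \<open>L x'\<close>, so they cannot have the same sign.\<close>
  have opposite: "L x * L x' < 0"
  proof (rule ccontr)
    assume "\<not> ?thesis"
    then consider "L x > 0" "L x' > 0" | "L x < 0" "L x' < 0"
      using nz[of x] nz[of x'] C(4) C'(4) by (auto simp: mult_less_0_iff not_less linorder_neq_iff)
    then show False
    proof cases
      case 1
      then have "(1 - t) * L x \<ge> 0" "t * L x' \<ge> 0" using t by auto
      with lin have "(1 - t) * L x = 0" "t * L x' = 0" by linarith+
      with 1 show False by auto
    next
      case 2
      then have "(1 - t) * L x \<le> 0" "t * L x' \<le> 0" using t by (auto simp: mult_nonneg_nonpos)
      with lin have "(1 - t) * L x = 0" "t * L x' = 0" by linarith+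
      with 2 show False by auto
    qed
  qed
  have same: "L u * L v > 0" if "u \<in> C \<and> v \<in> C \<or> u \<in> C' \<and> v \<in> C'" for u v
  proof (rule ccontr)
    assume "\<not> ?thesis"
    moreover have "L u \<noteq> 0" "L v \<noteq> 0" using nz that by auto
    ultimately consider "L u \<le> 0" "L v \<ge> 0" | "L v \<le> 0" "L u \<ge> 0"
      by (auto simp: zero_less_mult_iff not_less linorder_neq_iff)
    then show False
      using across[of C u v] across[of C v u] across[of C' u v] across[of C' v u] that C C'
      by cases auto
  qed
  obtain u u' where u: "u \<in> D" "u \<in> C" "u' \<in> D" "u' \<in> C'" using D by auto
  have "L u * L x > 0" "L u' * L x' > 0" using same u C(4) C'(4) by auto
  with opposite consider "L u \<le> 0" "L u' \<ge> 0" | "L u' \<le> 0" "L u \<ge> 0"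
    by (auto simp: zero_less_mult_iff mult_less_0_iff)
  then show ?thesis
    by cases (use across[OF D(1,2) u(1,3)] across[OF D(1,2) u(3,1)] in blast)+
qed

text \<open>The chord of y 3 meets the disjoint chords of x 0, x 1, x 2. The one it meets in the middle,
  say that of x j, separates the other two, so the chord of y j, which meets those two, meets it as well.\<close>
lemma circle_graph_no_cube:
  fixes x y :: "nat \<Rightarrow> 'a"
  assumes circle: "circle_graph V E"
    and V: "\<And>i. i < 4 \<Longrightarrow> x i \<in> V \<and> y i \<in> V"
    and xx: "\<And>i j. i < 4 \<Longrightarrow> j < 4 \<Longrightarrow> \<not> E (x i) (x j)"
    and xy: "\<And>i j. i < 4 \<Longrightarrow> j < 4 \<Longrightarrow> E (x i) (y j) \<longleftrightarrow> i \<noteq> j"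
  shows False
proof -
  obtain a b :: "'a \<Rightarrow> complex" where
    chord: "\<forall>v\<in>V. norm (a v) = 1 \<and> norm (b v) = 1 \<and> a v \<noteq> b v" and
    E_iff: "\<forall>v\<in>V. \<forall>w\<in>V. v \<noteq> w \<longrightarrow>
        (E v w \<longleftrightarrow> closed_segment (a v) (b v) \<inter> closed_segment (a w) (b w) \<noteq> {})"
    using circle unfolding circle_graph_def by (elim exE conjE) (erule (1) that)
  define S where "S = (\<lambda>v. closed_segment (a v) (b v))"
  have E_S: "E v w \<longleftrightarrow> S v \<inter> S w \<noteq> {}" if "v \<in> V" "w \<in> V" "v \<noteq> w" for v w
    using E_iff that unfolding S_def by simp
  have cvx: "convex (S v)" for v unfolding S_def by auto
  have disc: "S v \<subseteq> cball 0 1" if "v \<in> V" for v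
    unfolding S_def using chord that by (intro closed_segment_subset) auto
  have x_inj: "x i \<noteq> x j" if "i < 4" "j < 4" "i \<noteq> j" for i j
    using xy[of i i] xy[of j i] that by metis
  have x_y: "x i \<noteq> y j" if "i < 4" "j < 4" for i j
  proof
    assume eq: "x i = y j"
    \<comment> \<open>Any index other than \<open>j\<close> will do: \<open>x k\<close> is adjacent
      to \<open>y j\<close>, but not to \<open>x i\<close>.\<close>
    obtain k :: nat where k: "k < 4" "k \<noteq> j"
      by (rule that[of "if j = 0 then 1 else 0"]) auto
    then have "E (x k) (x i)" using xy[of k j] that eq by simp
    with xx[of k i] k that show False by simp
  qed
  have disj: "S (x i) \<inter> S (x j) = {}" if "i < 4" "j < 4" "i \<noteq> j" for i j
    using E_S[of "x i" "x j"] xx[of i j] x_inj[of i j] V that by blast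
  have cross: "S (x i) \<inter> S (y j) = {} \<longleftrightarrow> i = j" if "i < 4" "j < 4" for i j
    using E_S[of "x i" "y j"] xy[of i j] x_y[of i j] V that by blast
  have middle: False
    if ij: "i < 4" "j < 4" "k < 4" "i \<noteq> j" "j \<noteq> k"
      and z: "z \<in> S (x i)" "z' \<in> S (x k)" "w \<in> S (x j)" "w \<in> closed_segment z z'" for i j k z z' w
  proof -
    have "S (y j) \<inter> closed_segment (a (x j)) (b (x j)) \<noteq> {}"
    proof (rule chord_separates[of _ _ "S (x i)" z "S (x k)" z' w])
      show "S (y j) \<inter> S (x i) \<noteq> {}" "S (y j) \<inter> S (x k) \<noteq> {}"
        using cross[of i j] cross[of k j] ij by auto
      show "S (x i) \<inter> closed_segment (a (x j)) (b (x j)) = {}"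
        "S (x k) \<inter> closed_segment (a (x j)) (b (x j)) = {}"
        using disj[of i j] disj[of k j] ij unfolding S_def by auto
      show "w \<in> closed_segment (a (x j)) (b (x j))" using z(3) unfolding S_def .
    qed (use ij z bspec[OF chord, of "x j"] V[of i] V[of j] V[of k] cvx disc in blast)+
    then show False using cross[of j j] ij unfolding S_def by auto
  qed
  have "S (x i) \<inter> S (y 3) \<noteq> {}" if "i < 3" for i using cross[of i 3] that by auto
  then have "\<exists>z. i < 3 \<longrightarrow> z \<in> S (x i) \<and> z \<in> S (y 3)" for i by blast
  then obtain z where z: "\<And>i. i < 3 \<Longrightarrow> z i \<in> S (x i) \<and> z i \<in> S (y 3)"
    by metis
  \<comment> \<open>The three crossing points lie on one chord, so one of them is between the other
    two; this decides which of the three chords plays the middle role.\<close>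
  have "{z 0, z 1, z 2} \<subseteq> S (y 3)" using z by auto
  then have "collinear {z 0, z 1, z 2}"
    unfolding S_def using collinear_closed_segment collinear_subset by blast
  then consider "z 0 \<in> closed_segment (z 1) (z 2)" | "z 1 \<in> closed_segment (z 2) (z 0)"
    | "z 2 \<in> closed_segment (z 0) (z 1)"
    unfolding collinear_between_cases between_mem_segment by blast
  then show False
    using middle[of 1 0 2 "z 1" "z 2" "z 0"] middle[of 2 1 0 "z 2" "z 0" "z 1"]
      middle[of 0 2 1 "z 0" "z 1" "z 2"] z[of 0] z[of 1] z[of 2]
    by cases simp_all
qed

section \<open>Continuous logarithms of maps into the punctured plane\<close>

text \<open>Having a quotient with a continuous logarithm is an equivalence relation between the
  times of the homotopy. By compactness of \<open>T\<close> its classes are open, and the interval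
  is connected, so there is only one class.\<close>

lemma log_along_homotopy:
  fixes H :: "real \<times> 'a::topological_space \<Rightarrow> complex"
  assumes T: "compact T" and H: "continuous_on ({0..1} \<times> T) H" and nz: "\<And>z. z \<in> {0..1} \<times> T \<Longrightarrow> H z \<noteq> 0"
  shows "\<exists>l. continuous_on T l \<and> (\<forall>x\<in>T. H (1, x) = H (0, x) * exp (l x))"
proof -
  define R where "R = (\<lambda>s t. \<exists>l. continuous_on T l \<and> (\<forall>x\<in>T. H (t, x) = H (s, x) * exp (l x)))"
  have slice: "continuous_on T (\<lambda>x. H (t, x))" if "t \<in> {0..1}" for t
    by (rule continuous_on_compose2[OF H]) (use that in \<open>auto intro!: continuous_intros\<close>)
  have "R 0 1"
  proof (rule connected_equivalence_relation[of "{0..1::real}"])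
    show "R t s" if st: "R s t" for s t
    proof -
      obtain l where "continuous_on T l" "\<forall>x\<in>T. H (t, x) = H (s, x) * exp (l x)"
    using st unfolding R_def by auto
      then show ?thesis unfolding R_def
        by (intro exI[of _ "\<lambda>x. - l x"]) (auto intro!: continuous_intros simp: exp_minus)
    qed
    show "R r t" if rs: "R r s" and st: "R s t" for r s t
    proof -
      obtain l where "continuous_on T l" "\<forall>x\<in>T. H (s, x) = H (r, x) * exp (l x)"
        using rs unfolding R_def by auto
      moreover obtain l' where "continuous_on T l'" "\<forall>x\<in>T. H (t, x) = H (s, x) * exp (l' x)"
        using st unfolding R_def by auto
      ultimately show ?thesis unfolding R_def
        by (intro exI[of _ "\<lambda>x. l x + l' x"]) (auto intro!: continuous_intros simp: exp_add)
    qed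
    show "\<exists>U. openin (top_of_set {0..1}) U \<and> t \<in> U \<and> (\<forall>s\<in>U. R t s)" if t: "t \<in> {0..1}" for t
    proof -
      \<comment> \<open>On \<open>O'\<close> the quotient is within distance 1 of 1, hence off the
        branch cut of \<open>Ln\<close>. The tube lemma turns this into a neighbourhood of
        \<open>t\<close> that works for all points of \<open>T\<close> at once.\<close>
      define O' where "O' = {z \<in> {0..1} \<times> T. norm (H z / H (t, snd z) - 1) < 1}"
      have "continuous_on ({0..1} \<times> T) (\<lambda>z. H (t, snd z))"
        by (rule continuous_on_compose2[OF slice[OF t]]) (auto intro!: continuous_intros)
      then have "continuous_on ({0..1} \<times> T) (\<lambda>z. norm (H z / H (t, snd z) - 1))"
        using nz t by (intro continuous_intros H) auto
      then have "openin (top_of_set ({0..1} \<times> T))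
          (({0..1} \<times> T) \<inter> (\<lambda>z. norm (H z / H (t, snd z) - 1)) -` {..<1})"
        by (rule continuous_openin_preimage_gen) (rule open_lessThan)
      also have "({0..1} \<times> T) \<inter> (\<lambda>z. norm (H z / H (t, snd z) - 1)) -` {..<1} = O'"
        unfolding O'_def by auto
      finally have "openin (top_of_set ({0..1} \<times> T)) O'" .
      then have "openin (prod_topology (top_of_set {0..1}) (top_of_set T)) O'"
        by (simp add: subtopology_Times[symmetric] euclidean_product_topology)
      moreover have "compactin (top_of_set T) T"
        using T by (simp add: compactin_subtopology)
      moreover have "{t} \<times> T \<subseteq> O'"
        using t nz by (auto simp: O'_def)
      ultimately have "\<exists>U U'. openin (top_of_set {0..1}) U \<and> openin (top_of_set T) U' \<and>
          t \<in> U \<and> T \<subseteq> U' \<and> U \<times> U' \<subseteq> O'"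
        using t by (intro tube_lemma_right) auto
      then obtain U U' where U: "openin (top_of_set {0..1}) U" "t \<in> U" "T \<subseteq> U'" "U \<times> U' \<subseteq> O'"
        by (elim exE conjE)
      have "R t s" if s: "s \<in> U" for s
      proof -
        have *: "(s, x) \<in> O'" if "x \<in> T" for x
          using subsetD[OF U(4), of "(s, x)"] subsetD[OF U(3) that] s by simp
        have near: "norm (H (s, x) / H (t, x) - 1) < 1" and s01: "s \<in> {0..1}" if "x \<in> T" for x
          using *[OF that] unfolding O'_def by simp_all
        have slit: "H (s, x) / H (t, x) \<notin> \<real>\<^sub>\<le>\<^sub>0" if "x \<in> T" for x
        proof
          assume "H (s, x) / H (t, x) \<in> \<real>\<^sub>\<le>\<^sub>0"
          then obtain r where "H (s, x) / H (t, x) = of_real r" "r \<le> 0"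
            by (auto elim: nonpos_Reals_cases)
          moreover have "norm (complex_of_real r - 1) = \<bar>r - 1\<bar>"
            by (metis norm_of_real of_real_1 of_real_diff)
          ultimately show False using near[OF that] by auto
        qed
        have "continuous_on T (\<lambda>x. Ln (H (s, x) / H (t, x)))"
        \<comment> \<open>The fact \<open>s01\<close> gets \<open>s \<in> {0..1}\<close> from a
          point of \<open>T\<close>, so the empty \<open>T\<close> is treated apart.\<close>
        proof (cases "T = {}")
          case False
          then have "s \<in> {0..1}" using s01 by auto
          then show ?thesis
            using slit nz t by (intro continuous_intros slice) auto
        qed auto
        moreover have "H (s, x) = H (t, x) * exp (Ln (H (s, x) / H (t, x)))" if "x \<in> T" for x
          using nz[of "(s, x)"] nz[of "(t, x)"] that t s01[OF that] by simp
        ultimately show ?thesis unfolding R_def by blast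
      qed
      then show ?thesis using U by blast
    qed
  qed auto
  then show ?thesis unfolding R_def .
qed

text \<open>The difference takes its values in the integer multiples of
  \<open>2 * pi * \<i>\<close>, a set whose distinct points are at least \<open>2 * pi\<close>
  apart; a continuous function with such values is constant on a connected set.\<close>

lemma logs_differ_by_constant:
  fixes u v :: "'a::topological_space \<Rightarrow> complex"
  assumes "connected S" "continuous_on S u" "continuous_on S v"
    and eq: "\<And>x. x \<in> S \<Longrightarrow> exp (u x) = exp (v x)" and "x \<in> S" "y \<in> S"
  shows "u x - v x = u y - v y"
proof -
  have "(\<lambda>x. u x - v x) constant_on S"
  proof (rule continuous_discrete_range_constant)
    show "continuous_on S (\<lambda>x. u x - v x)" by (intro continuous_intros assms)
    fix x assume x: "x \<in> S"
    have "2 * pi \<le> norm ((u y - v y) - (u x - v x))"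
      if y: "y \<in> S" and ne: "u y - v y \<noteq> u x - v x" for y
    proof -
      obtain m n :: int where "u x = v x + of_int (2 * m) * pi * \<i>" "u y = v y + of_int (2 * n) * pi * \<i>"
        using eq[OF x] eq[OF y] unfolding exp_eq by (auto simp: mult_ac)
      then have *: "(u y - v y) - (u x - v x) = of_real (2 * pi * of_int (n - m)) * \<i>"
        by (simp add: algebra_simps)
      with ne have "n \<noteq> m" by auto
      then have "\<bar>real_of_int (n - m)\<bar> \<ge> 1" by linarith
      then show ?thesis unfolding * norm_mult norm_of_real by (simp add: abs_mult del: of_int_diff)
    qed
    then show "\<exists>e>0. \<forall>y. y \<in> S \<and> u y - v y \<noteq> u x - v x \<longrightarrow> e \<le> norm ((u y - v y) - (u x - v x))"
      by (intro exI[of _ "2 * pi"]) auto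
  qed fact
  with assms(5,6) show ?thesis unfolding constant_on_def by metis
qed

section \<open>Points of the realization and logarithms on its two halves\<close>

definition simplex_points :: "'a set \<Rightarrow> ('a \<Rightarrow> real) set" where
  "simplex_points \<sigma> = {f. (\<forall>x. 0 \<le> f x) \<and> (\<forall>x. x \<notin> \<sigma> \<longrightarrow> f x = 0) \<and> sum f \<sigma> = 1}"

definition complex_points :: "'a set \<Rightarrow> ('a \<Rightarrow> 'a \<Rightarrow> bool) \<Rightarrow> ('a \<Rightarrow> real) set" where
  "complex_points V E = (\<Union>\<sigma>\<in>{\<sigma>. ind_simplex V E \<sigma>}. simplex_points \<sigma>)"

definition line_point :: "('a \<Rightarrow> real) \<Rightarrow> ('a \<Rightarrow> real) \<Rightarrow> real \<Rightarrow> 'a \<Rightarrow> real" where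
  "line_point f g t = (\<lambda>x. (1 - t) * f x + t * g x)"

lemma independence_complex_realization_eq:
  "independence_complex_realization V E = top_of_set (complex_points V E)"
  unfolding independence_complex_realization_def complex_points_def simplex_points_def
    euclidean_product_topology
  by (rule arg_cong[where f = "subtopology euclidean"]) auto

lemma line_point_ends [simp]: "line_point f g 0 = f" "line_point f g 1 = g"
  by (auto simp: line_point_def)

lemma sum_line_point: "sum (line_point f g t) A = (1 - t) * sum f A + t * sum g A"
  by (simp add: line_point_def sum.distrib sum_distrib_left)

lemma simplex_points_line_point:
  assumes "f \<in> simplex_points \<sigma>" "g \<in> simplex_points \<sigma>" "0 \<le> t" "t \<le> 1"
  shows "line_point f g t \<in> simplex_points \<sigma>"
  using assms sum_line_point[of f g t \<sigma>]
  by (auto simp: simplex_points_def line_point_def)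

lemma simplex_points_mono:
  assumes "f \<in> simplex_points \<tau>" "\<tau> \<subseteq> \<sigma>" "finite \<sigma>"
  shows "f \<in> simplex_points \<sigma>"
proof -
  have "sum f \<tau> = sum f \<sigma>"
    using assms by (intro sum.mono_neutral_left) (auto simp: simplex_points_def)
  then show ?thesis using assms by (auto simp: simplex_points_def)
qed

lemma continuous_on_line_point:
  fixes f g :: "'b::topological_space \<Rightarrow> 'a \<Rightarrow> real"
  assumes "continuous_on S f" "continuous_on S g" "continuous_on S t"
  shows "continuous_on S (\<lambda>z. line_point (f z) (g z) (t z))"
proof -
  have "continuous_on S (\<lambda>z. f z x)" "continuous_on S (\<lambda>z. g z x)" for x
    by (rule continuous_on_product_then_coordinatewise, fact)+
  then show ?thesis
    unfolding line_point_def
    by (intro continuous_on_coordinatewise_then_product continuous_on_add continuous_on_mult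
        continuous_on_diff continuous_on_const assms)
qed

text \<open>A closed subset of the cube of all functions into [0,1], which is compact by Tychonoff
  even if the vertex type is infinite.\<close>

lemma compact_simplex_points:
  assumes "finite \<sigma>"
  shows "compact (simplex_points \<sigma>)"
proof -
  have "compactin (product_topology (\<lambda>_. euclideanreal) UNIV) (PiE UNIV (\<lambda>_::'a. {0..1::real}))"
    by (simp add: compactin_PiE)
  then have cube: "compact (PiE UNIV (\<lambda>_::'a. {0..1::real}))"
    by (simp add: euclidean_product_topology)
  have coord: "continuous_on UNIV (\<lambda>f::'a \<Rightarrow> real. f x)" for x
    by (rule continuous_on_product_coordinates)
  have "closed (\<Inter>x. {f::'a \<Rightarrow> real. 0 \<le> f x})"
    by (intro closed_INT ballI closed_Collect_le coord continuous_on_const)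
  moreover have "closed (\<Inter>x\<in>- \<sigma>. {f::'a \<Rightarrow> real. f x = 0})"
    by (intro closed_INT ballI closed_Collect_eq coord continuous_on_const)
  moreover have "closed {f::'a \<Rightarrow> real. sum f \<sigma> = 1}"
    by (intro closed_Collect_eq continuous_on_sum coord continuous_on_const)
  ultimately have "closed ((\<Inter>x. {f. 0 \<le> f x}) \<inter> (\<Inter>x\<in>- \<sigma>. {f. f x = 0}) \<inter> {f::'a \<Rightarrow> real. sum f \<sigma> = 1})"
    by (intro closed_Int)
  also have "\<dots> = simplex_points \<sigma>" by (auto simp: simplex_points_def)
  finally have "compact (PiE UNIV (\<lambda>_. {0..1}) \<inter> simplex_points \<sigma>)"
    by (intro compact_Int_closed cube)
  moreover have "f x \<le> 1" if "f \<in> simplex_points \<sigma>" for f x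
  proof (cases "x \<in> \<sigma>")
    case True
    with member_le_sum[of x \<sigma> f] assms that show ?thesis by (auto simp: simplex_points_def)
  qed (use that in \<open>auto simp: simplex_points_def\<close>)
  then have "PiE UNIV (\<lambda>_. {0..1}) \<inter> simplex_points \<sigma> = simplex_points \<sigma>"
    by (auto simp: simplex_points_def)
  ultimately show ?thesis by simp
qed

lemma compact_complex_points:
  assumes "finite V"
  shows "compact (complex_points V E)"
  unfolding complex_points_def
proof (rule compact_UN)
  show "finite {\<sigma>. ind_simplex V E \<sigma>}"
    by (rule finite_subset[of _ "Pow V"]) (use assms in \<open>auto simp: ind_simplex_def\<close>)
  show "compact (simplex_points \<sigma>)" if "\<sigma> \<in> {\<sigma>. ind_simplex V E \<sigma>}" for \<sigma>
    using that assms by (auto simp: ind_simplex_def intro!: compact_simplex_points intro: finite_subset)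
qed

lemma closed_sum_ge: "closed {f::'a \<Rightarrow> real. c \<le> sum f A}"
  by (intro closed_Collect_le continuous_on_sum continuous_on_product_coordinates continuous_on_const)

text \<open>The points with mass at least 1/2 on A contract, by renormalising onto the simplex spanned
  by A and then shrinking that simplex to a vertex.\<close>
lemma log_on_half:
  assumes V: "finite V" and A: "A \<subseteq> V" "\<And>v w. v \<in> A \<Longrightarrow> w \<in> A \<Longrightarrow> \<not> E v w"
    and g: "continuous_on (complex_points V E) g" "\<And>f. f \<in> complex_points V E \<Longrightarrow> g f \<noteq> 0"
  shows "\<exists>l. continuous_on (complex_points V E \<inter> {f. 1/2 \<le> sum f A}) l \<and>
    (\<forall>f\<in>complex_points V E \<inter> {f. 1/2 \<le> sum f A}. g f = exp (l f :: complex))"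
proof (cases "A = {}")
  case True
  then show ?thesis by auto
next
  case False
  then obtain a where a: "a \<in> A" by auto
  define T where "T = complex_points V E \<inter> {f. 1/2 \<le> sum f A}"
  define r where "r = (\<lambda>f x. if x \<in> A then f x / sum f A else 0 :: real)"
  define c where "c = (\<lambda>x. if x = a then 1 else 0 :: real)"
  have fin: "finite A" using A V finite_subset by blast
  have ind_A: "ind_simplex V E A" using A False by (auto simp: ind_simplex_def)
  have comp: "compact T" unfolding T_def by (intro compact_Int_closed compact_complex_points V closed_sum_ge)
  have c: "c \<in> simplex_points A" using a fin by (auto simp: simplex_points_def c_def)
  have r: "r f \<in> simplex_points A"
    and homotopy_in: "0 \<le> t \<Longrightarrow> t \<le> 1 \<Longrightarrow> line_point f (r f) t \<in> complex_points V E"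
    if f: "f \<in> T" for f t
  proof -
    obtain \<sigma> where \<sigma>: "ind_simplex V E \<sigma>" "f \<in> simplex_points \<sigma>"
      using f by (auto simp: T_def complex_points_def)
    have pos: "sum f A \<ge> 1/2" using f by (auto simp: T_def)
    have fin_\<sigma>: "finite \<sigma>" using \<sigma> V by (auto simp: ind_simplex_def intro: finite_subset)
    have "sum (r f) A = sum f A / sum f A"
      unfolding sum_divide_distrib by (intro sum.cong) (auto simp: r_def)
    with pos have sum_r: "sum (r f) A = 1" by simp
    \<comment> \<open>The support of \<open>r f\<close> lies in both \<open>\<sigma>\<close> and
      \<open>A\<close>. The first keeps the segment from \<open>f\<close> to \<open>r f\<close> in a
      single simplex; the second lets the next homotopy, from \<open>r f\<close> to the vertex
      \<open>c\<close>, run in the simplex \<open>A\<close>.\<close>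
    have zero: "r f x = 0" if "x \<notin> \<sigma> \<inter> A" for x
      using that \<sigma> by (auto simp: r_def simplex_points_def)
    have "sum (r f) (\<sigma> \<inter> A) = sum (r f) A"
      using zero fin by (intro sum.mono_neutral_left) auto
    then have "r f \<in> simplex_points (\<sigma> \<inter> A)"
      using zero sum_r pos \<sigma> unfolding simplex_points_def by (auto simp: r_def)
    then have "r f \<in> simplex_points \<sigma>" and *: "r f \<in> simplex_points A"
      using simplex_points_mono fin fin_\<sigma> by (metis inf_le1, metis inf_le2)
    then show "line_point f (r f) t \<in> complex_points V E" if "0 \<le> t" "t \<le> 1"
      using simplex_points_line_point[OF \<sigma>(2) _ that] \<sigma> unfolding complex_points_def by blast
    show "r f \<in> simplex_points A" by fact
  qed
  have homotopy_in': "line_point (r f) c t \<in> complex_points V E" if "f \<in> T" "0 \<le> t" "t \<le> 1" for f t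
    using simplex_points_line_point[OF r[OF that(1)] c that(2,3)] ind_A unfolding complex_points_def by blast
  have cont_r: "continuous_on T r"
  proof (rule continuous_on_coordinatewise_then_product)
    fix x
    have coord: "continuous_on T (\<lambda>f. f y)" for y
      by (rule continuous_on_subset[OF continuous_on_product_coordinates]) simp
    have "continuous_on T (\<lambda>f. f x / sum f A)"
      by (intro continuous_on_divide continuous_on_sum coord) (auto simp: T_def)
    then show "continuous_on T (\<lambda>f. r f x)" by (cases "x \<in> A") (simp_all add: r_def)
  qed
  have cont_r': "continuous_on ({0..1::real} \<times> T) (\<lambda>z. r (snd z))"
    by (rule continuous_on_compose2[OF cont_r continuous_on_snd[OF continuous_on_id]]) auto
  have "continuous_on ({0..1} \<times> T) (\<lambda>z. g (line_point (snd z) (r (snd z)) (fst z)))"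
    by (rule continuous_on_compose2[OF g(1) continuous_on_line_point[OF continuous_on_snd[OF continuous_on_id] cont_r'
          continuous_on_fst[OF continuous_on_id]]])
      (use homotopy_in in auto)
  from log_along_homotopy[OF comp this] obtain l1 where
    l1: "continuous_on T l1" "\<forall>f\<in>T. g (r f) = g f * exp (l1 f)"
    using homotopy_in g(2) by auto
  have "continuous_on ({0..1} \<times> T) (\<lambda>z. g (line_point (r (snd z)) c (fst z)))"
    by (rule continuous_on_compose2[OF g(1) continuous_on_line_point[OF cont_r' continuous_on_const
          continuous_on_fst[OF continuous_on_id]]])
      (use homotopy_in' in auto)
  from log_along_homotopy[OF comp this] obtain l2 where
    l2: "continuous_on T l2" "\<forall>f\<in>T. g c = g (r f) * exp (l2 f)"
    using homotopy_in' g(2) by auto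
  have "g c \<noteq> 0"
    using g(2)[of c] c ind_A unfolding complex_points_def by blast
  \<comment> \<open>The two homotopies give \<open>g c = g f * exp (l1 f) * exp (l2 f)\<close>, and
    the nonzero constant \<open>g c\<close> has the logarithm \<open>Ln (g c)\<close>.\<close>
  have "continuous_on T (\<lambda>f. Ln (g c) - l2 f - l1 f)"
    by (intro continuous_intros l1 l2)
  moreover have "g f = exp (Ln (g c) - l2 f - l1 f)" if "f \<in> T" for f
  proof -
    have "g c = g f * exp (l1 f) * exp (l2 f)" using l1 l2 that by simp
    then show ?thesis using \<open>g c \<noteq> 0\<close> by (simp add: exp_diff)
  qed
  ultimately show ?thesis unfolding T_def[symmetric] by blast
qed

text \<open>The segment from \<open>f\<close> to \<open>f'\<close> stays in the simplex and keeps
  mass exactly 1/2 on both \<open>A\<close> and \<open>B\<close>, so both logarithms are defined all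
  along it.\<close>

lemma jump_constant_on_simplex:
  fixes l l' :: "('a \<Rightarrow> real) \<Rightarrow> complex"
  assumes \<sigma>: "ind_simplex V E \<sigma>" "f \<in> simplex_points \<sigma>" "f' \<in> simplex_points \<sigma>"
    and half: "sum f A = 1/2" "sum f' A = 1/2" "sum f B = 1/2" "sum f' B = 1/2"
    and cont: "continuous_on (complex_points V E \<inter> {f. 1/2 \<le> sum f A}) l"
      "continuous_on (complex_points V E \<inter> {f. 1/2 \<le> sum f B}) l'"
    and logs: "\<And>f. f \<in> complex_points V E \<inter> {f. 1/2 \<le> sum f A} \<Longrightarrow> g f = exp (l f)"
      "\<And>f. f \<in> complex_points V E \<inter> {f. 1/2 \<le> sum f B} \<Longrightarrow> g f = exp (l' f)"
  shows "l f - l' f = l f' - l' f'"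
proof -
  define S where "S = line_point f f' ` {0..1}"
  have "continuous_on {0..1} (line_point f f')"
    by (intro continuous_on_line_point continuous_on_const continuous_on_id)
  then have conn: "connected S"
    unfolding S_def by (intro connected_continuous_image) auto
  have ends: "f \<in> S" "f' \<in> S"
    unfolding S_def by (auto intro: image_eqI[of _ _ 0] image_eqI[of _ _ 1])
  have sub: "S \<subseteq> complex_points V E \<inter> {f. 1/2 \<le> sum f A}" "S \<subseteq> complex_points V E \<inter> {f. 1/2 \<le> sum f B}"
    using simplex_points_line_point[OF \<sigma>(2,3)] \<sigma>(1) half
    by (auto simp: S_def complex_points_def sum_line_point field_simps)
  show ?thesis
  proof (rule logs_differ_by_constant[OF conn _ _ _ ends])
    show "continuous_on S l" "continuous_on S l'"
      using cont[THEN continuous_on_subset] sub by blast+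
    show "exp (l h) = exp (l' h)" if "h \<in> S" for h
      using logs(1)[OF subsetD[OF sub(1) that]] logs(2)[OF subsetD[OF sub(2) that]] by simp
  qed
qed

section \<open>Integer jumps and the dependence of three maps\<close>

text \<open>The cross product of \<open>u\<close> and \<open>w\<close> is a solution. If it
  vanishes, the two vectors are parallel, and any nonzero integer vector orthogonal to a nonzero one
  of them, or any at all if both are zero, serves.\<close>

lemma two_integer_equations:
  fixes u w :: "nat \<Rightarrow> int"
  shows "\<exists>n::nat \<Rightarrow> int. (\<exists>j<3. n j \<noteq> 0) \<and> (\<Sum>j<3. n j * u j) = 0 \<and> (\<Sum>j<3. n j * w j) = 0"
proof -
  have sum3: "(\<Sum>j<3. f j) = f 0 + f 1 + f 2" for f :: "nat \<Rightarrow> int"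
    by (simp add: numeral_3_eq_3 numeral_2_eq_2)
  have sol: ?thesis
    if "p \<noteq> 0 \<or> q \<noteq> 0 \<or> r \<noteq> 0" "p * u 0 + q * u 1 + r * u 2 = 0" "p * w 0 + q * w 1 + r * w 2 = 0"
    for p q r
  proof (intro exI[of _ "\<lambda>j. if j = 0 then p else if j = 1 then q else r"] conjI)
    show "\<exists>j<3::nat. (if j = 0 then p else if j = 1 then q else r) \<noteq> 0"
      using that(1) by (auto simp: numeral_3_eq_3 Ex_less_Suc)
  qed (use that in \<open>simp_all add: sum3\<close>)
  show ?thesis
  proof (cases "u 1 * w 2 = u 2 * w 1 \<and> u 2 * w 0 = u 0 * w 2 \<and> u 0 * w 1 = u 1 * w 0")
    case False
    then show ?thesis
      by (intro sol[of "u 1 * w 2 - u 2 * w 1" "u 2 * w 0 - u 0 * w 2" "u 0 * w 1 - u 1 * w 0"])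
        (auto simp: algebra_simps)
  next
    case parallel: True
    show ?thesis
    proof (cases "u 0 = 0 \<and> u 1 = 0 \<and> u 2 = 0")
      case True
      then show ?thesis
        using sol[of "w 1" "- w 0" 0] sol[of 1 0 0] by (cases "w 0 = 0 \<and> w 1 = 0") auto
    next
      case False
      then show ?thesis
        using parallel sol[of "u 1" "- u 0" 0] sol[of 1 0 0] by (cases "u 0 = 0 \<and> u 1 = 0") auto
    qed
  qed
qed

lemma subset_three_or_four_distinct:
  "(\<exists>v0 v1 v2. D \<subseteq> {v0, v1, v2}) \<or>
    (\<exists>v::nat \<Rightarrow> 'b. (\<forall>i<4. v i \<in> D) \<and> (\<forall>i<4. \<forall>j<4. i \<noteq> j \<longrightarrow> v i \<noteq> v j))"
proof (rule disjCI)
  assume "\<not> (\<exists>v::nat \<Rightarrow> 'b. (\<forall>i<4. v i \<in> D) \<and> (\<forall>i<4. \<forall>j<4. i \<noteq> j \<longrightarrow> v i \<noteq> v j))"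
  then have *: "\<not> ((\<forall>i<4. v i \<in> D) \<and> (\<forall>i<4. \<forall>j<4. i \<noteq> j \<longrightarrow> v i \<noteq> v j))" for v :: "nat \<Rightarrow> 'b"
    by blast
  have no4: "\<not> (a \<in> D \<and> b \<in> D \<and> c \<in> D \<and> d \<in> D \<and> a \<noteq> b \<and> a \<noteq> c \<and> a \<noteq> d \<and> b \<noteq> c \<and> b \<noteq> d \<and> c \<noteq> d)"
    for a b c d
    using *[of "\<lambda>i. if i = 0 then a else if i = 1 then b else if i = 2 then c else d"]
    by (auto simp: less_Suc_eq numeral_eq_Suc split: if_splits)
  show "\<exists>v0 v1 v2. D \<subseteq> {v0, v1, v2}"
  proof (rule ccontr)
    assume "\<not> ?thesis"
    then have ex: "\<exists>d\<in>D. d \<notin> {a, b, c}" for a b c by blast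
    obtain a where "a \<in> D" using ex by blast
    moreover obtain b where "b \<in> D" "b \<noteq> a" using ex[of a a a] by auto
    moreover obtain c where "c \<in> D" "c \<noteq> a" "c \<noteq> b" using ex[of a b b] by auto
    moreover obtain d where "d \<in> D" "d \<noteq> a" "d \<noteq> b" "d \<noteq> c" using ex[of a b c] by auto
    ultimately show False using no4[of a b c d] by auto
  qed
qed

text \<open>This expresses that the first cohomology has rank at most two. A product of powers gets
  a global logarithm once its jump is the same at all of the at most three values \<open>v0\<close>,
  \<open>v1\<close>, \<open>v2\<close>; that is two linear equations for three integer
  exponents.\<close>

lemma three_circle_maps_dependent:
  fixes V :: "'a set" and g :: "nat \<Rightarrow> ('a \<Rightarrow> real) \<Rightarrow> complex"
  assumes sg: "simple_graph V E" and circle: "circle_graph V E" and bip: "bipartite V E"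
    and g: "\<And>j. continuous_on (complex_points V E) (g j)"
      "\<And>j f. f \<in> complex_points V E \<Longrightarrow> g j f \<noteq> 0"
  shows "\<exists>n::nat \<Rightarrow> int. (\<exists>j<3. n j \<noteq> 0) \<and> (\<exists>L. continuous_on (complex_points V E) L \<and>
    (\<forall>f\<in>complex_points V E. (\<Prod>j<3. g j f powi n j) = exp (L f)))"
proof -
  obtain A where A: "A \<subseteq> V" "\<And>v w. E v w \<Longrightarrow> v \<in> A \<longleftrightarrow> w \<notin> A"
    using bip unfolding bipartite_def by blast
  define B where "B = V - A"
  have fin: "finite V" and E_sym: "\<And>v w. E v w \<Longrightarrow> E w v"
    using sg unfolding simple_graph_def by blast+
  have B: "B \<subseteq> V" "A \<inter> B = {}" "A \<union> B = V" using A(1) by (auto simp: B_def)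
  have finA: "finite A" and finB: "finite B" using fin A(1) B(1) finite_subset by blast+
  have indep_A: "\<not> E v w" if "v \<in> A" "w \<in> A" for v w using A(2)[of v w] that by blast
  have indep_B: "\<not> E v w" if "v \<in> B" "w \<in> B" for v w using A(2)[of v w] that by (auto simp: B_def)
  define X where "X = complex_points V E"
  define XA where "XA = X \<inter> {f. 1/2 \<le> sum f A}"
  define XB where "XB = X \<inter> {f. 1/2 \<le> sum f B}"
  have "\<exists>l. continuous_on XA l \<and> (\<forall>f\<in>XA. g j f = exp (l f))" for j
    unfolding XA_def X_def by (rule log_on_half[OF fin A(1) indep_A g])
  then obtain l where l: "\<And>j. continuous_on XA (l j)" "\<And>j f. f \<in> XA \<Longrightarrow> g j f = exp (l j f)"
    by metis
  have "\<exists>l. continuous_on XB l \<and> (\<forall>f\<in>XB. g j f = exp (l f))" for j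
    unfolding XB_def X_def by (rule log_on_half[OF fin B(1) indep_B g])
  then obtain l' where l': "\<And>j. continuous_on XB (l' j)" "\<And>j f. f \<in> XB \<Longrightarrow> g j f = exp (l' j f)"
    by metis
  \<comment> \<open>The midpoint of the edge from \<open>a\<close> to \<open>b\<close>, the simplest
    point with mass 1/2 on each colour class.\<close>
  define m where "m = (\<lambda>(a::'a) b x. if x = a \<or> x = b then 1/2 else 0 :: real)"
  have m_halves: "sum (m a b) A = 1/2" "sum (m a b) B = 1/2" if "a \<in> A" "b \<in> B" for a b
  proof -
    have "sum (m a b) A = (\<Sum>x\<in>A. if x = a then 1/2 else 0)"
      using that B(2) by (intro sum.cong) (auto simp: m_def)
    then show "sum (m a b) A = 1/2" using that finA by simp
    have "sum (m a b) B = (\<Sum>x\<in>B. if x = b then 1/2 else 0)"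
      using that B(2) by (intro sum.cong) (auto simp: m_def)
    then show "sum (m a b) B = 1/2" using that finB by simp
  qed
  have m_simplex: "m a b \<in> simplex_points \<sigma>"
    if "a \<in> A" "b \<in> B" "a \<in> \<sigma>" "b \<in> \<sigma>" "\<sigma> \<subseteq> V" for a b \<sigma>
  proof (rule simplex_points_mono)
    have "a \<noteq> b" using that B(2) by blast
    then show "m a b \<in> simplex_points {a, b}"
      by (auto simp: simplex_points_def m_def)
    show "finite \<sigma>" using that(5) fin finite_subset by blast
  qed (use that in auto)
  have jump: "l j f - l' j f = l j f' - l' j f'"
    if "ind_simplex V E \<sigma>" "f \<in> simplex_points \<sigma>" "f' \<in> simplex_points \<sigma>"
      "sum f A = 1/2" "sum f' A = 1/2" "sum f B = 1/2" "sum f' B = 1/2" for j \<sigma> f f'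
    by (rule jump_constant_on_simplex[OF that l(1)[of j, unfolded XA_def X_def]
          l'(1)[of j, unfolded XB_def X_def], where g = "g j"])
      (use l(2)[of _ j] l'(2)[of _ j] in \<open>simp_all add: XA_def XB_def X_def\<close>)
  have "\<exists>d::int. l j (m a b) - l' j (m a b) = of_int d * (2 * pi * \<i>)"
    if "a \<in> A" "b \<in> B" "\<not> E a b" for j a b
  proof -
    have "\<not> E b a" using that E_sym by blast
    then have ind: "ind_simplex V E {a, b}"
      using that A(1) B(1) by (auto simp: ind_simplex_def indep_A indep_B)
    then have "m a b \<in> X"
      using m_simplex[of a b "{a, b}"] that A(1) B(1) unfolding X_def complex_points_def by blast
    then have "m a b \<in> XA" "m a b \<in> XB" using m_halves that by (auto simp: XA_def XB_def)
    then have "exp (l j (m a b)) = exp (l' j (m a b))" using l(2) l'(2) by metis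
    then obtain d :: int where "l j (m a b) = l' j (m a b) + of_int (2 * d) * pi * \<i>"
      unfolding exp_eq by auto
    then show ?thesis by (intro exI[of _ d]) simp
  qed
  then obtain d :: "'a \<Rightarrow> 'a \<Rightarrow> nat \<Rightarrow> int" where
    d: "\<And>a b j. a \<in> A \<Longrightarrow> b \<in> B \<Longrightarrow> \<not> E a b \<Longrightarrow> l j (m a b) - l' j (m a b) = of_int (d a b j) * (2 * pi * \<i>)"
    by metis
  \<comment> \<open>If the pairs share a vertex, their union is still independent: each of its cross
    pairs is one of the two given non-adjacent pairs. Both midpoints then lie in one simplex, where
    the jump is constant.\<close>
  have d_eqI: "d a b = d a' b'"
    if "a \<in> A" "b \<in> B" "\<not> E a b" "a' \<in> A" "b' \<in> B" "\<not> E a' b'" "a = a' \<or> b = b'" for a b a' b'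
  proof
    fix j
    have "\<not> E a b'" "\<not> E a' b" "\<not> E b a" "\<not> E b' a'" "\<not> E b' a" "\<not> E b a'"
      using that E_sym by blast+
    then have ind: "ind_simplex V E {a, b, a', b'}"
      using that(1-6) A(1) B(1) by (auto simp: ind_simplex_def indep_A indep_B)
    have "l j (m a b) - l' j (m a b) = l j (m a' b') - l' j (m a' b')"
      by (rule jump[OF ind m_simplex m_simplex m_halves(1) m_halves(1) m_halves(2) m_halves(2)])
        (use that A(1) B(1) in auto)
    with that show "d a b j = d a' b' j" by (simp add: d)
  qed
  define D where "D = {d a b | a b. a \<in> A \<and> b \<in> B \<and> \<not> E a b}"
  have "\<not> (\<exists>v::nat \<Rightarrow> nat \<Rightarrow> int. (\<forall>i<4. v i \<in> D) \<and> (\<forall>i<4. \<forall>j<4. i \<noteq> j \<longrightarrow> v i \<noteq> v j))"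
  proof
    assume "\<exists>v::nat \<Rightarrow> nat \<Rightarrow> int. (\<forall>i<4. v i \<in> D) \<and> (\<forall>i<4. \<forall>j<4. i \<noteq> j \<longrightarrow> v i \<noteq> v j)"
    then obtain v :: "nat \<Rightarrow> nat \<Rightarrow> int" where
      v: "\<forall>i<4. v i \<in> D" "\<forall>i<4. \<forall>j<4. i \<noteq> j \<longrightarrow> v i \<noteq> v j"
      by (elim exE conjE) (rule that)
    have "\<exists>a b. i < 4 \<longrightarrow> v i = d a b \<and> a \<in> A \<and> b \<in> B \<and> \<not> E a b" for i
      using v(1) unfolding D_def by auto
    then obtain x y where xy: "\<And>i. i < 4 \<Longrightarrow> v i = d (x i) (y i) \<and> x i \<in> A \<and> y i \<in> B \<and> \<not> E (x i) (y i)"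
      by metis
    have "E (x i) (y j) \<longleftrightarrow> i \<noteq> j" if ij: "i < 4" "j < 4" for i j
    proof
      show "E (x i) (y j)" if "i \<noteq> j"
      proof (rule ccontr)
        assume "\<not> ?thesis"
        \<comment> \<open>If \<open>x i\<close> and \<open>y j\<close> were non-adjacent, the value
          would pass from pair \<open>i\<close> to the pair \<open>x i\<close>, \<open>y j\<close>
          and on to pair \<open>j\<close>, one vertex being shared each time.\<close>
        then have "d (x i) (y i) = d (x i) (y j)" "d (x i) (y j) = d (x j) (y j)"
          using xy[of i] xy[of j] ij by (auto intro!: d_eqI)
        then have "v i = v j" using xy[of i] xy[of j] ij by simp
        with v(2) ij that show False by blast
      qed
    qed (use xy[of i] ij in auto)
    moreover have "x i \<in> V \<and> y i \<in> V" if "i < 4" for i using xy[OF that] A(1) B(1) by blast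
    moreover have "\<not> E (x i) (x j)" if "i < 4" "j < 4" for i j using xy indep_A that by blast
    ultimately show False by (intro circle_graph_no_cube[OF circle, of x y])
  qed
  then obtain v0 v1 v2 where D: "D \<subseteq> {v0, v1, v2}"
    using subset_three_or_four_distinct[of D] by blast
  \<comment> \<open>The exponents kill the differences \<open>v1 - v0\<close> and
    \<open>v2 - v0\<close>, so the combined jump equals that of \<open>v0\<close> for every value in
    \<open>D\<close>.\<close>
  obtain n where n: "\<exists>j<3. n j \<noteq> (0::int)"
    "(\<Sum>j<3. n j * (v1 j - v0 j)) = 0" "(\<Sum>j<3. n j * (v2 j - v0 j)) = 0"
    using two_integer_equations[of "\<lambda>j. v1 j - v0 j" "\<lambda>j. v2 j - v0 j"] by auto
  have n_D: "(\<Sum>j<3. n j * v j) = (\<Sum>j<3. n j * v0 j)" if "v \<in> D" for v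
    using that D n(2,3) by (auto simp: right_diff_distrib sum_subtractf)
  \<comment> \<open>The common value of the combined jump. It is an integer multiple of
    \<open>2 * pi * \<i>\<close>, so adding it on the \<open>B\<close> half leaves the exponential
    alone while making the two logarithms match on the common boundary.\<close>
  define \<delta> where "\<delta> = of_int (\<Sum>j<3. n j * v0 j) * (2 * pi * \<i>)"
  have exp_\<delta>: "exp \<delta> = 1"
    unfolding exp_eq_1 \<delta>_def by (auto intro!: exI[of _ "\<Sum>j<3. n j * v0 j"])
  define L where "L = (\<lambda>f. if 1/2 \<le> sum f A then \<Sum>j<3. of_int (n j) * l j f
      else (\<Sum>j<3. of_int (n j) * l' j f) + \<delta>)"
  have X_cases: "sum f A + sum f B = 1" if fX: "f \<in> X" for f
  proof -
    obtain \<sigma> where \<sigma>: "ind_simplex V E \<sigma>" "f \<in> simplex_points \<sigma>"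
      using fX unfolding X_def complex_points_def by blast
    then have "f \<in> simplex_points V"
      using simplex_points_mono fin unfolding ind_simplex_def by metis
    then have "sum f (A \<union> B) = 1" using B(3) by (simp add: simplex_points_def)
    then show ?thesis using sum.union_disjoint[OF finA finB B(2), of f] by simp
  qed
  have X_Un: "XA \<union> XB = X"
    using X_cases by (force simp: XA_def XB_def)
  have agree: "(\<Sum>j<3. of_int (n j) * l j f) = (\<Sum>j<3. of_int (n j) * l' j f) + \<delta>"
    if f: "f \<in> XA" "f \<in> XB" for f
  proof -
    have half: "sum f A = 1/2" "sum f B = 1/2"
      using f X_cases[of f] by (auto simp: XA_def XB_def)
    obtain \<sigma> where \<sigma>: "ind_simplex V E \<sigma>" "f \<in> simplex_points \<sigma>"
      using f unfolding XA_def X_def complex_points_def by blast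
    \<comment> \<open>Mass 1/2 on each class gives a support vertex of \<open>f\<close> in each. The
      jump at \<open>f\<close> can then be read off at their midpoint, inside the same
      simplex.\<close>
    have "\<exists>x\<in>A. f x \<noteq> 0" "\<exists>x\<in>B. f x \<noteq> 0"
      using half sum.neutral[of A f] sum.neutral[of B f] by (metis zero_neq_one divide_eq_0_iff zero_neq_numeral)+
    then obtain a b where ab: "a \<in> A" "b \<in> B" "a \<in> \<sigma>" "b \<in> \<sigma>"
      using \<sigma>(2) unfolding simplex_points_def by blast
    then have nE: "\<not> E a b" using \<sigma>(1) by (auto simp: ind_simplex_def)
    have "l j f - l' j f = l j (m a b) - l' j (m a b)" for j
      by (rule jump[OF \<sigma> m_simplex half(1) m_halves(1) half(2) m_halves(2)])
        (use ab \<sigma>(1) in \<open>auto simp: ind_simplex_def\<close>)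
    then have lj: "l j f = l' j f + of_int (d a b j) * (2 * pi * \<i>)" for j
      using d[OF ab(1,2) nE, of j] by (metis add.commute diff_add_cancel)
    have "(\<Sum>j<3. of_int (n j) * l j f) =
        (\<Sum>j<3. of_int (n j) * l' j f) + of_int (\<Sum>j<3. n j * d a b j) * (2 * pi * \<i>)"
      by (simp add: lj distrib_left sum.distrib sum_distrib_right mult.assoc)
    also have "(\<Sum>j<3. n j * d a b j) = (\<Sum>j<3. n j * v0 j)"
      using ab nE by (intro n_D) (auto simp: D_def)
    finally show ?thesis unfolding \<delta>_def .
  qed
  have "continuous_on (XA \<union> XB) L"
    unfolding L_def
  proof (rule continuous_on_cases_local)
    show "closedin (top_of_set (XA \<union> XB)) XA" "closedin (top_of_set (XA \<union> XB)) XB"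
      unfolding X_Un unfolding XA_def XB_def by (intro closedin_closed_Int closed_sum_ge)+
    show "continuous_on XA (\<lambda>f. \<Sum>j<3. of_int (n j) * l j f)"
      "continuous_on XB (\<lambda>f. (\<Sum>j<3. of_int (n j) * l' j f) + \<delta>)"
      by (intro continuous_intros l l')+
    show "(\<Sum>j<3. of_int (n j) * l j f) = (\<Sum>j<3. of_int (n j) * l' j f) + \<delta>"
      if "f \<in> XA \<and> \<not> 1/2 \<le> sum f A \<or> f \<in> XB \<and> 1/2 \<le> sum f A" for f
      using that by (intro agree) (auto simp: XA_def XB_def)
  qed
  moreover have "(\<Prod>j<3. g j f powi n j) = exp (L f)" if "f \<in> X" for f
  proof (cases "1/2 \<le> sum f A")
    case True
    then have "g j f = exp (l j f)" for j using that l(2) by (simp add: XA_def)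
    with True show ?thesis by (simp add: L_def exp_sum exp_power_int)
  next
    case False
    then have "f \<in> XB" using X_Un that by (auto simp: XA_def)
    then have "g j f = exp (l' j f)" for j using l'(2) by simp
    with False show ?thesis by (simp add: L_def exp_add exp_\<delta> exp_sum exp_power_int)
  qed
  ultimately show ?thesis using n(1) unfolding X_Un X_def by blast
qed

section \<open>Projections of the wedge onto its circles\<close>

text \<open>The retraction onto one circle, rescaled to the unit circle. The sign is chosen so that
  the wedge point 0 goes to 1, in accordance with the value on the other circles;
  \<open>Suc j\<close> appears because circles are counted from 1 and maps from 0.\<close>

definition wedge_map :: "nat \<Rightarrow> complex \<Rightarrow> complex" where
  "wedge_map j z = (if z \<in> sphere (of_nat (Suc j)) (Suc j) then (of_nat (Suc j) - z) / of_nat (Suc j) else 1)"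

text \<open>The circle with index \<open>i\<close> has the equation
  \<open>(norm z)^2 = 2 * i * Re z\<close>. Subtracting two of these gives \<open>Re z = 0\<close>,
  and then \<open>z = 0\<close>.\<close>

lemma tangent_spheres:
  fixes z :: complex
  assumes "z \<in> sphere (of_nat i) (real i)" "z \<in> sphere (of_nat j) (real j)" "i \<noteq> j"
  shows "z = 0"
proof -
  have *: "(Re z)\<^sup>2 + (Im z)\<^sup>2 = 2 * real i * Re z" if "z \<in> sphere (of_nat i) (real i)" for i
  proof -
    have "(norm (of_nat i - z))\<^sup>2 = (real i)\<^sup>2" using that by (simp add: dist_norm)
    then show ?thesis unfolding cmod_power2 by (simp add: power2_eq_square algebra_simps)
  qed
  from *[OF assms(1)] *[OF assms(2)] have "(real i - real j) * Re z = 0" by (simp add: algebra_simps)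
  with assms(3) have "Re z = 0" by simp
  with *[OF assms(1)] show ?thesis by (simp add: complex_eq_iff)
qed

lemma wedge_map_nonzero: "wedge_map j z \<noteq> 0"
proof -
  have False if "of_nat (Suc j) = z" "z \<in> sphere (of_nat (Suc j)) (Suc j)"
    using that by (simp del: of_nat_Suc)
  then show ?thesis unfolding wedge_map_def by (auto simp del: of_nat_Suc)
qed

lemma wedge_map_other:
  assumes "z \<in> sphere (of_nat i) (real i)" "i \<noteq> Suc j"
  shows "wedge_map j z = 1"
  using tangent_spheres[OF assms(1) _ assms(2)] unfolding wedge_map_def by (auto simp del: of_nat_Suc)

text \<open>The closed sets \<open>C\<close> and \<open>R\<close> can meet only in the wedge point,
  where the formula on \<open>C\<close> also has the value 1.\<close>

lemma continuous_on_wedge_map: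
  "continuous_on (\<Union>i\<in>{1..k}. sphere (of_nat i) (of_nat i)) (wedge_map j)"
proof -
  define C :: "complex set" where "C = sphere (of_nat (Suc j)) (Suc j)"
  define R :: "complex set" where "R = (\<Union>i\<in>{1..k} - {Suc j}. sphere (of_nat i) (of_nat i))"
  have "continuous_on (C \<union> R) (\<lambda>z. if z \<in> C then (of_nat (Suc j) - z) / of_nat (Suc j) else 1)"
  proof (rule continuous_on_cases)
    show "closed C" "closed R" unfolding C_def R_def by auto
    show "continuous_on C (\<lambda>z. (of_nat (Suc j) - z) / of_nat (Suc j))"
      by (intro continuous_intros) (simp del: of_nat_Suc)
    show "\<forall>z. z \<in> C \<and> z \<notin> C \<or> z \<in> R \<and> z \<in> C \<longrightarrow> (of_nat (Suc j) - z) / of_nat (Suc j) = 1"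
      using tangent_spheres[of _ _ "Suc j"] unfolding C_def R_def by (auto simp del: of_nat_Suc)
  qed auto
  then have "continuous_on (C \<union> R) (wedge_map j)"
    unfolding wedge_map_def C_def .
  moreover have "sphere (of_nat i) (of_nat i) \<subseteq> C \<union> R" if "i \<in> {1..k}" for i
    using that unfolding C_def R_def by (cases "i = Suc j") blast+
  then have "(\<Union>i\<in>{1..k}. sphere (of_nat i) (of_nat i)) \<subseteq> C \<union> R" by blast
  ultimately show ?thesis by (rule continuous_on_subset)
qed

text \<open>A winding number argument: once around circle \<open>Suc j\<close> the product winds
  \<open>n j\<close> times, while a continuous logarithm returns to its starting value.\<close>

lemma wedge_maps_independent:
  fixes n :: "nat \<Rightarrow> int" and k :: nat
  defines "W \<equiv> \<Union>i\<in>{1..k}. sphere (of_nat i :: complex) (of_nat i)"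
  assumes L: "continuous_on W L" "\<And>z. z \<in> W \<Longrightarrow> (\<Prod>j<m. wedge_map j z powi n j) = exp (L z)"
    and j: "j < m" "j < k"
  shows "n j = 0"
proof -
  \<comment> \<open>This loop is parametrised so that
    \<open>wedge_map j (z t) = exp (\<i> * t)\<close>, while every other \<open>wedge_map\<close> is
    1 along it.\<close>
  define z where "z = (\<lambda>t. of_nat (Suc j) - of_nat (Suc j) * exp (\<i> * of_real t))"
  have sph: "z t \<in> sphere (of_nat (Suc j)) (of_nat (Suc j))" for t
    by (simp add: z_def dist_norm norm_mult del: of_nat_Suc)
  have "Suc j \<in> {1..k}" using j by simp
  then have zW: "z t \<in> W" for t
    unfolding W_def using sph[of t] by blast
  have "continuous_on {0..2 * pi} (\<lambda>t. L (z t))"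
    by (rule continuous_on_compose2[OF L(1)]) (use zW in \<open>auto simp: z_def intro!: continuous_intros\<close>)
  moreover have "exp (L (z t)) = exp (of_int (n j) * (\<i> * of_real t))" for t
  proof -
    have "wedge_map i (z t) = 1" if "i \<noteq> j" for i
      using wedge_map_other[OF sph] that by auto
    then have "(\<Prod>i<m. wedge_map i (z t) powi n i) = (\<Prod>i<m. if i = j then wedge_map i (z t) powi n i else 1)"
      by (intro prod.cong) auto
    also have "\<dots> = wedge_map j (z t) powi n j" using j by simp
    also have "wedge_map j (z t) = exp (\<i> * of_real t)"
      using sph[of t] unfolding wedge_map_def by (simp add: z_def del: of_nat_Suc)
    finally show ?thesis using L(2)[OF zW, of t] by (simp add: exp_power_int)
  qed
  moreover have "continuous_on {0..2 * pi} (\<lambda>t. of_int (n j) * (\<i> * of_real t))"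
    by (intro continuous_intros)
  ultimately have "L (z 0) - of_int (n j) * (\<i> * of_real 0) =
      L (z (2 * pi)) - of_int (n j) * (\<i> * of_real (2 * pi))"
    by (intro logs_differ_by_constant[of "{0..2 * pi}"]) auto
  moreover have "z (2 * pi) = z 0"
    using exp_two_pi_i by (simp add: z_def mult_ac del: of_nat_Suc)
  ultimately show ?thesis by simp
qed

section \<open>Transfer along the homotopy equivalence\<close>

theorem mainTheorem7:
  fixes V :: "'a set" and E :: "'a \<Rightarrow> 'a \<Rightarrow> bool" and k :: nat
  assumes "simple_graph V E" and "circle_graph V E" and "bipartite V E" and "k \<ge> 3"
  shows "\<not> (independence_complex_realization V E homotopy_equivalent_space wedge_of_circles k)"
proof
  define X where "X = complex_points V E"
  define W where "W = (\<Union>i\<in>{1..k}. sphere (of_nat i :: complex) (of_nat i))"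
  assume "independence_complex_realization V E homotopy_equivalent_space wedge_of_circles k"
  then obtain F G where F: "continuous_on X F" "F \<in> X \<rightarrow> W" and G: "continuous_on W G" "G \<in> W \<rightarrow> X"
    and FG: "homotopic_with (\<lambda>_. True) (top_of_set W) (top_of_set W) (F \<circ> G) id"
    unfolding homotopy_equivalent_space_def independence_complex_realization_eq wedge_of_circles_def
      X_def W_def by auto
  have wedge: "continuous_on W (wedge_map j)" for j
    unfolding W_def by (rule continuous_on_wedge_map)
  have cont_F: "continuous_on X (\<lambda>f. wedge_map j (F f))" for j
    by (rule continuous_on_compose2[OF wedge F(1)]) (use F in auto)
  have "\<exists>n::nat \<Rightarrow> int. (\<exists>j<3. n j \<noteq> 0) \<and> (\<exists>L. continuous_on X L \<and>
      (\<forall>f\<in>X. (\<Prod>j<3. wedge_map j (F f) powi n j) = exp (L f)))"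
    unfolding X_def
    by (rule three_circle_maps_dependent[OF assms(1-3) cont_F[unfolded X_def] wedge_map_nonzero])
  then obtain n :: "nat \<Rightarrow> int" and i L where n: "i < 3" "n i \<noteq> 0" and L: "continuous_on X L"
    "\<forall>f\<in>X. (\<Prod>j<3. wedge_map j (F f) powi n j) = exp (L f)"
    by (elim exE conjE) (rule that)
  \<comment> \<open>\<open>L\<close> is a logarithm of \<open>q\<close> after \<open>F\<close>, so
    \<open>L\<close> after \<open>G\<close> is one of \<open>q\<close> after \<open>F\<close> and
    \<open>G\<close>. The homotopy from \<open>F \<circ> G\<close> to the identity corrects it by
    \<open>l\<close> to a logarithm of \<open>q\<close> on the wedge itself.\<close>
  define q where "q = (\<lambda>z. \<Prod>j<3. wedge_map j z powi n j)"
  have q: "continuous_on W q" "q z \<noteq> 0" for z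
    unfolding q_def using wedge_map_nonzero by (auto intro!: continuous_intros wedge)
  obtain h where h: "continuous_on ({0..1::real} \<times> W) h" "h \<in> {0..1} \<times> W \<rightarrow> W"
    "\<forall>z. h (0, z) = F (G z)" "\<forall>z. h (1, z) = z"
    using FG unfolding homotopic_with_def
    by (auto simp: subtopology_Times[symmetric])
  have "compact W" unfolding W_def by (intro compact_UN) auto
  moreover have "continuous_on ({0..1} \<times> W) (\<lambda>z. q (h z))"
    by (rule continuous_on_compose2[OF q(1) h(1)]) (use h in auto)
  ultimately obtain l where l: "continuous_on W l" "\<And>z. z \<in> W \<Longrightarrow> q z = q (F (G z)) * exp (l z)"
    using log_along_homotopy[of W "\<lambda>z. q (h z)"] q(2) h(3,4) by auto
  have cont: "continuous_on W (\<lambda>z. L (G z) + l z)"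
    by (intro continuous_intros l(1) continuous_on_compose2[OF L(1) G(1)]) (use G in auto)
  have log_q: "(\<Prod>j<3. wedge_map j z powi n j) = exp (L (G z) + l z)" if "z \<in> W" for z
    using l(2)[OF that] bspec[OF L(2), of "G z"] G(2) that by (auto simp: q_def exp_add)
  \<comment> \<open>Here \<open>k \<ge> 3\<close> enters: the index \<open>i < 3\<close> belongs to
    an actual circle of the wedge.\<close>
  have "n i = 0"
    using wedge_maps_independent[OF cont[unfolded W_def] log_q[unfolded W_def], of i] n(1) assms(4) by simp
  with n(2) show False by contradiction
qed

end
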